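(* Suppose that $X\in 2^\omega$ is Martin-Löf random (with respect to Lebesgue measure) and that $f\le_{\mathrm{wtt}}X$ is a function $f:\omega\to\omega$ that dominates all computable functions. Then there is an anti-complex proper sequence $Y\in 2^\omega$ with $Y\equiv_{\mathrm T}X$.
   Context: $f\le_{\mathrm{wtt}}X$ means that $f$ is computable from $X$ by a Turing functional whose use is bounded by a computable function. A function $f$ dominates $g$ if $f(n)\ge g(n)$ for all sufficiently large $n$. All measures are Borel probability measures on Cantor space $2^\omega$. A measure $\mu$ is computable if $\sigma\mapsto\mu(\{X:\sigma\prec X\})$ is a computable real-valued function on finite binary strings. A $\mu$-Martin-Löf test is a uniformly $\Sigma^0_1$ sequence $(\mathcal U_i)_{i\in\omega}$ with $\mu(\mathcal U_i)\le 2^{-i}$; $X$ is $\mu$-Martin-Löf random if $X\notin\bigcap_i\mathcal U_i$ for every such test. $X$ is proper if it is $\mu$-Martin-Löf random for some computable measure $\mu$. $\mathrm K$ is prefix-free Kolmogorov complexity; $X\upharpoonright n$ is the initial segment of $X$ of length $n$; an order is a non-decreasing unbounded function $h:\omega\to\omega$ with $h(0)=0$. $X$ is anti-complex if for every computable order $h$, $\mathrm K(X\upharpoonright h(n))\le n$ for all but finitely many $n$. *)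

theory Defs
  imports "HOL-Probability.Probability" "HOL-Library.Nat_Bijection" "HOL-Library.Sublist"
begin

section \<open>Oracle computability\<close>

text \<open>
  Kleene's partial recursive functions relative to an oracle, in unary form: several arguments
  are packed into one number by \<^const>\<open>prod_encode\<close>.  The judgement \<open>runs X D p n m\<close>
  says that \<open>p\<close> with oracle \<open>X\<close> halts on \<open>n\<close> with output \<open>m\<close> and that every oracle
  query made during this computation lies in \<open>D\<close>.  Thus \<open>D = UNIV\<close> is unrestricted oracle
  computation, \<open>D = {..<u}\<close> says that the use is at most \<open>u\<close>, and \<open>D = {}\<close> is
  computation without an oracle.
\<close>

datatype prog =
    Zero | Succ | Fst | Snd | Query
  | Pairing prog prog
  | Comp prog prog
  | Rec prog prog
  | Mu prog

inductive runs :: "(nat \<Rightarrow> bool) \<Rightarrow> nat set \<Rightarrow> prog \<Rightarrow> nat \<Rightarrow> nat \<Rightarrow> bool"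
  for X :: "nat \<Rightarrow> bool" and D :: "nat set"
where
  zero: "runs X D Zero n 0"
| succ: "runs X D Succ n (Suc n)"
| fst: "runs X D Fst (prod_encode (a, b)) a"
| snd: "runs X D Snd (prod_encode (a, b)) b"
| query: "n \<in> D \<Longrightarrow> runs X D Query n (of_bool (X n))"
| pairing: "runs X D p n a \<Longrightarrow> runs X D q n b \<Longrightarrow> runs X D (Pairing p q) n (prod_encode (a, b))"
| comp: "runs X D q n a \<Longrightarrow> runs X D p a b \<Longrightarrow> runs X D (Comp p q) n b"
| rec_0: "runs X D p a b \<Longrightarrow> runs X D (Rec p q) (prod_encode (a, 0)) b"
| rec_Suc: "runs X D (Rec p q) (prod_encode (a, k)) r \<Longrightarrow>
    runs X D q (prod_encode (a, prod_encode (k, r))) b \<Longrightarrow>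
    runs X D (Rec p q) (prod_encode (a, Suc k)) b"
| mu: "runs X D p (prod_encode (n, k)) 0 \<Longrightarrow>
    (\<forall>j<k. \<exists>m>0. runs X D p (prod_encode (n, j)) m) \<Longrightarrow>
    runs X D (Mu p) n k"

text \<open>The oracle \<^term>\<open>\<lambda>_. False\<close> below is a dummy: it is never queried.\<close>

definition phi :: "prog \<Rightarrow> nat \<Rightarrow> nat \<Rightarrow> bool" where
  "phi p n m \<longleftrightarrow> runs (\<lambda>_. False) {} p n m"

definition computable :: "(nat \<Rightarrow> nat) \<Rightarrow> bool" where
  "computable f \<longleftrightarrow> (\<exists>p. \<forall>n. phi p n (f n))"

definition ce :: "nat set \<Rightarrow> bool" where
  "ce W \<longleftrightarrow> (\<exists>p. W = {n. \<exists>m. phi p n m})"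

definition computable_from :: "(nat \<Rightarrow> nat) \<Rightarrow> (nat \<Rightarrow> bool) \<Rightarrow> bool" where
  "computable_from f X \<longleftrightarrow> (\<exists>p. \<forall>n. runs X UNIV p n (f n))"

definition wtt_le :: "(nat \<Rightarrow> nat) \<Rightarrow> (nat \<Rightarrow> bool) \<Rightarrow> bool" where
  "wtt_le f X \<longleftrightarrow> (\<exists>p g. computable g \<and> (\<forall>n. runs X {..<g n} p n (f n)))"

definition turing_le :: "(nat \<Rightarrow> bool) \<Rightarrow> (nat \<Rightarrow> bool) \<Rightarrow> bool" where
  "turing_le Y X \<longleftrightarrow> computable_from (\<lambda>n. of_bool (Y n)) X"

definition turing_equiv :: "(nat \<Rightarrow> bool) \<Rightarrow> (nat \<Rightarrow> bool) \<Rightarrow> bool" where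
  "turing_equiv Y X \<longleftrightarrow> turing_le Y X \<and> turing_le X Y"

definition dominates :: "(nat \<Rightarrow> nat) \<Rightarrow> (nat \<Rightarrow> nat) \<Rightarrow> bool" where
  "dominates f g \<longleftrightarrow> (\<forall>\<^sub>F n in sequentially. f n \<ge> g n)"

lemma runs_mono: "runs X D p n m \<Longrightarrow> D \<subseteq> D' \<Longrightarrow> runs X D' p n m"
proof (induction rule: runs.induct)
  case (query n)
  then have "n \<in> D'" by blast
  then show ?case by (rule runs.query)
next
  case (pairing p n a q b)
  show ?case by (rule runs.pairing[OF pairing.IH(1)[OF pairing.prems] pairing.IH(2)[OF pairing.prems]])
next
  case (comp q n a p b)
  show ?case by (rule runs.comp[OF comp.IH(1)[OF comp.prems] comp.IH(2)[OF comp.prems]])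
next
  case (rec_0 p a b q)
  show ?case by (rule runs.rec_0[OF rec_0.IH[OF rec_0.prems]])
next
  case (rec_Suc p q a k r b)
  show ?case by (rule runs.rec_Suc[OF rec_Suc.IH(1)[OF rec_Suc.prems] rec_Suc.IH(2)[OF rec_Suc.prems]])
next
  case (mu p n k)
  show ?case
  proof (rule runs.mu)
    show "runs X D' p (prod_encode (n, k)) 0" using mu by blast
    show "\<forall>j<k. \<exists>m>0. runs X D' p (prod_encode (n, j)) m" using mu by blast
  qed
qed (rule runs.zero runs.succ runs.fst runs.snd)+

lemma runs_det: "runs X D p n m \<Longrightarrow> runs X D p n m' \<Longrightarrow> m = m'"
proof (induction arbitrary: m' rule: runs.induct)
  case (mu p n k)
  from mu.prems show ?case
  proof (cases rule: runs.cases)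
    case mu': mu
    have "\<not> m' < k"
    proof
      assume "m' < k"
      with mu.IH(2) obtain m where m: "m > 0"
        "\<forall>l. runs X D p (prod_encode (n, m')) l \<longrightarrow> m = l" by auto
      have "m = 0" by (rule spec[OF m(2), of 0, THEN mp, OF mu'(1)])
      with m(1) show False by simp
    qed
    moreover have "\<not> k < m'"
    proof
      assume "k < m'"
      with mu'(2) obtain m where m: "m > 0" "runs X D p (prod_encode (n, k)) m" by auto
      have "0 = m" by (rule mu.IH(1)[OF m(2)])
      with m(1) show False by simp
    qed
    ultimately show ?thesis by simp
  qed
next
  case (pairing p n a q b)
  from pairing.prems show ?case
    by (cases rule: runs.cases) (simp add: pairing.IH)
next
  case (comp q n a p b)
  from comp.prems show ?case
  proof (cases rule: runs.cases)
    case comp': (comp a')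
    from comp.IH(1)[OF comp'(1)] have "a = a'" .
    then show ?thesis using comp'(2) by (intro comp.IH(2)) simp
  qed
next
  case (rec_0 p a b q)
  from rec_0.prems show ?case
    by (cases rule: runs.cases) (simp_all add: rec_0.IH)
next
  case (rec_Suc p q a k r b)
  from rec_Suc.prems show ?case
  proof (cases rule: runs.cases)
    case rec': (rec_Suc a' k' r')
    then have "r = r'" by (intro rec_Suc.IH(1)) simp
    with rec' show ?thesis by (intro rec_Suc.IH(2)) simp
  qed simp
qed (erule runs.cases; simp)+


section \<open>Strings, Cantor space and measures\<close>

definition str_code :: "bool list \<Rightarrow> nat" where
  "str_code \<sigma> = list_encode (map of_bool \<sigma>)"

definition init_seg :: "(nat \<Rightarrow> bool) \<Rightarrow> nat \<Rightarrow> bool list" where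
  "init_seg X n = map X [0..<n]"

definition cylinder :: "bool list \<Rightarrow> (nat \<Rightarrow> bool) set" where
  "cylinder \<sigma> = {X. init_seg X (length \<sigma>) = \<sigma>}"

text \<open>The topology on \<^typ>\<open>nat \<Rightarrow> bool\<close> is the product of the discrete topologies.\<close>

definition cantor_prob :: "(nat \<Rightarrow> bool) measure \<Rightarrow> bool" where
  "cantor_prob \<mu> \<longleftrightarrow> prob_space \<mu> \<and> sets \<mu> = sets borel"

definition lebesgue_cantor :: "(nat \<Rightarrow> bool) measure" where
  "lebesgue_cantor = PiM UNIV (\<lambda>_. measure_pmf (pmf_of_set UNIV))"

text \<open>Rational approximations are coded through the surjection \<^const>\<open>nat_to_rat_surj\<close>.\<close>

definition computable_real_fun :: "(bool list \<Rightarrow> real) \<Rightarrow> bool" where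
  "computable_real_fun r \<longleftrightarrow> (\<exists>q. computable q \<and>
     (\<forall>\<sigma> k. \<bar>r \<sigma> - of_rat (nat_to_rat_surj (q (prod_encode (str_code \<sigma>, k))))\<bar> \<le> (1/2) ^ k))"

definition computable_measure :: "(nat \<Rightarrow> bool) measure \<Rightarrow> bool" where
  "computable_measure \<mu> \<longleftrightarrow> cantor_prob \<mu> \<and> computable_real_fun (\<lambda>\<sigma>. measure \<mu> (cylinder \<sigma>))"


section \<open>Martin-Loef randomness\<close>

definition uniformly_sigma01 :: "(nat \<Rightarrow> (nat \<Rightarrow> bool) set) \<Rightarrow> bool" where
  "uniformly_sigma01 U \<longleftrightarrow> (\<exists>W. ce W \<and>
     (\<forall>i. U i = (\<Union>\<sigma>\<in>{\<sigma>. prod_encode (i, str_code \<sigma>) \<in> W}. cylinder \<sigma>)))"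

definition martin_loef_test :: "(nat \<Rightarrow> bool) measure \<Rightarrow> (nat \<Rightarrow> (nat \<Rightarrow> bool) set) \<Rightarrow> bool" where
  "martin_loef_test \<mu> U \<longleftrightarrow> uniformly_sigma01 U \<and> (\<forall>i. measure \<mu> (U i) \<le> (1/2) ^ i)"

definition martin_loef_random :: "(nat \<Rightarrow> bool) measure \<Rightarrow> (nat \<Rightarrow> bool) \<Rightarrow> bool" where
  "martin_loef_random \<mu> X \<longleftrightarrow> (\<forall>U. martin_loef_test \<mu> U \<longrightarrow> X \<notin> (\<Inter>i. U i))"

definition proper :: "(nat \<Rightarrow> bool) \<Rightarrow> bool" where
  "proper X \<longleftrightarrow> (\<exists>\<mu>. computable_measure \<mu> \<and> martin_loef_random \<mu> X)"


section \<open>Prefix-free complexity\<close>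

definition partial_computable_str :: "(bool list \<Rightarrow> bool list option) \<Rightarrow> bool" where
  "partial_computable_str M \<longleftrightarrow>
     (\<exists>p. \<forall>\<sigma> m. phi p (str_code \<sigma>) m \<longleftrightarrow> (\<exists>\<tau>. M \<sigma> = Some \<tau> \<and> m = str_code \<tau>))"

definition prefix_free_machine :: "(bool list \<Rightarrow> bool list option) \<Rightarrow> bool" where
  "prefix_free_machine M \<longleftrightarrow> partial_computable_str M \<and>
     (\<forall>\<sigma>\<in>dom M. \<forall>\<tau>\<in>dom M. \<not> strict_prefix \<sigma> \<tau>)"

text \<open>
  As usual, complexity is taken with respect to a fixed reference machine, which is required to
  be optimal among all prefix-free machines up to an additive constant.
\<close>

definition optimal_machine :: "(bool list \<Rightarrow> bool list option) \<Rightarrow> bool" where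
  "optimal_machine U \<longleftrightarrow> prefix_free_machine U \<and>
     (\<forall>M. prefix_free_machine M \<longrightarrow>
        (\<exists>c. \<forall>\<sigma> \<tau>. M \<sigma> = Some \<tau> \<longrightarrow> (\<exists>\<rho>. U \<rho> = Some \<tau> \<and> length \<rho> \<le> length \<sigma> + c)))"

definition K :: "(bool list \<Rightarrow> bool list option) \<Rightarrow> bool list \<Rightarrow> nat" where
  "K U \<tau> = (LEAST n. \<exists>\<rho>. U \<rho> = Some \<tau> \<and> length \<rho> = n)"

definition is_order :: "(nat \<Rightarrow> nat) \<Rightarrow> bool" where
  "is_order h \<longleftrightarrow> mono h \<and> \<not> bdd_above (range h) \<and> h 0 = 0"

definition anti_complex :: "(bool list \<Rightarrow> bool list option) \<Rightarrow> (nat \<Rightarrow> bool) \<Rightarrow> bool" where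
  "anti_complex U X \<longleftrightarrow> (\<forall>h. computable h \<and> is_order h \<longrightarrow>
     (\<forall>\<^sub>F n in sequentially. K U (init_seg X (h n)) \<le> n))"

lemma cylinder_Int: "cylinder \<sigma> = (\<Inter>i<length \<sigma>. {X. X i = \<sigma> ! i})"
proof -
  have "init_seg X (length \<sigma>) = \<sigma> \<longleftrightarrow> (\<forall>i<length \<sigma>. X i = \<sigma> ! i)" for X
    unfolding init_seg_def list_eq_iff_nth_eq by simp
  then show ?thesis unfolding cylinder_def by simp blast
qed

lemma open_cylinder: "open (cylinder \<sigma>)"
proof -
  have "open {X :: nat \<Rightarrow> bool. X i = b}" for i b
  proof -
    have "open ((\<lambda>X :: nat \<Rightarrow> bool. X i) -` {b})"
      by (intro open_vimage Topological_Spaces.open_discrete continuous_on_product_coordinates)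
    then show ?thesis by (simp add: vimage_def)
  qed
  then show ?thesis unfolding cylinder_Int by (intro open_INT) auto
qed

instance bool :: second_countable_topology
proof
  have "(open :: bool set \<Rightarrow> bool) = generate_topology UNIV"
    by (auto simp: fun_eq_iff Topological_Spaces.open_discrete intro: generate_topology.Basis)
  then show "\<exists>B :: bool set set. countable B \<and> open = generate_topology B"
    by (intro exI[of _ UNIV]) auto
qed

lemma cantor_prob_lebesgue: "cantor_prob lebesgue_cantor"
proof -
  interpret product_prob_space "\<lambda>_ :: nat. measure_pmf (pmf_of_set (UNIV :: bool set))" UNIV
    by unfold_locales
  have "sets (borel :: bool measure) = UNIV"
    by (auto intro: borel_open Topological_Spaces.open_discrete)
  then have "sets lebesgue_cantor = sets (PiM UNIV (\<lambda>_ :: nat. borel :: bool measure))"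
    unfolding lebesgue_cantor_def by (intro sets_PiM_cong) auto
  then show ?thesis
    unfolding cantor_prob_def
    by (simp add: sets_PiM_equal_borel) (simp add: lebesgue_cantor_def P.prob_space_axioms)
qed

lemma measure_lebesgue_cylinder: "measure lebesgue_cantor (cylinder \<sigma>) = (1/2) ^ length \<sigma>"
proof -
  interpret product_prob_space "\<lambda>_ :: nat. measure_pmf (pmf_of_set (UNIV :: bool set))" UNIV
    by unfold_locales
  let ?M = "\<lambda>_ :: nat. measure_pmf (pmf_of_set (UNIV :: bool set))"
  have "cylinder \<sigma> = prod_emb UNIV ?M {..<length \<sigma>} (\<Pi>\<^sub>E i\<in>{..<length \<sigma>}. {\<sigma> ! i})"
  proof (intro set_eqI)
    fix Y
    have "restrict Y {..<length \<sigma>} \<in> (\<Pi>\<^sub>E i\<in>{..<length \<sigma>}. {\<sigma> ! i}) \<longleftrightarrow> Y \<in> cylinder \<sigma>"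
      unfolding cylinder_Int by (auto simp: restrict_PiE_iff Pi_iff)
    then show "Y \<in> cylinder \<sigma> \<longleftrightarrow> Y \<in> prod_emb UNIV ?M {..<length \<sigma>} (\<Pi>\<^sub>E i\<in>{..<length \<sigma>}. {\<sigma> ! i})"
      unfolding prod_emb_def by simp
  qed
  moreover have "measure (PiM UNIV ?M) \<dots> = (\<Prod>i<length \<sigma>. measure (?M i) {\<sigma> ! i})"
    by (rule measure_PiM_emb) simp_all
  ultimately show ?thesis
    by (simp add: lebesgue_cantor_def measure_pmf_single)
qed

end

theory Submission
  imports Defs
begin

text \<open>
  Let \<open>Y\<close> be the set of all \<open>\<langle>n, b, m\<rangle>\<close> such that \<open>b = X n\<close> and the given computation of \<open>f n\<close> from
  \<open>X\<close> halts within \<open>m\<close> steps with output at most \<open>m\<close>.  Clocking the computation makes \<open>Y\<close> the image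
  of \<open>X\<close> under a functional \<open>\<Phi>\<close> that is total on all oracles and has computable use.  Hence the image
  of Lebesgue measure under \<open>\<Phi>\<close> is computable, and preimages of tests for it are tests for Lebesgue
  measure, so \<open>Y\<close> is proper.  Searching for a witness \<open>\<langle>b, m\<rangle>\<close> recovers \<open>X n\<close> from \<open>Y\<close>.
  For anti-complexity, an element \<open>\<langle>n, b, m\<rangle>\<close> of \<open>Y\<close> is at least \<open>f n\<close> and depends only on
  the first \<open>G n\<close> bits of \<open>X\<close>, with \<open>G\<close> computable since the reduction is weak truth-table.  As \<open>f\<close>
  dominates \<open>k \<mapsto> h (4 * G k)\<close>, the first \<open>h n\<close> bits of \<open>Y\<close> are determined by \<open>n\<close> and the first
  \<open>n div 4\<close> bits of \<open>X\<close>, for almost all \<open>n\<close>.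
\<close>

section \<open>Relative computability\<close>

abbreviation pfst :: "nat \<Rightarrow> nat" where "pfst x \<equiv> fst (prod_decode x)"
abbreviation psnd :: "nat \<Rightarrow> nat" where "psnd x \<equiv> snd (prod_decode x)"

text \<open>One notion covers \<open>computable\<close> (no queries) and
  \<open>computable_from\<close> (all queries), so each closure property is proved once for
  both.\<close>

definition rec_in :: "(nat \<Rightarrow> bool) \<Rightarrow> nat set \<Rightarrow> (nat \<Rightarrow> nat) \<Rightarrow> bool" where
  "rec_in X D f \<longleftrightarrow> (\<exists>p. \<forall>n. runs X D p n (f n))"

lemma computable_iff_rec_in: "computable f \<longleftrightarrow> rec_in (\<lambda>_. False) {} f"
  by (simp add: computable_def rec_in_def phi_def)

lemma computable_from_iff_rec_in: "computable_from f X \<longleftrightarrow> rec_in X UNIV f"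
  by (simp add: computable_from_def rec_in_def)

text \<open>The oracle enters only through queries in \<open>D\<close>, where the two oracles agree.
  This moves oracle-free programs to any oracle and computations from a finite oracle to
  \<open>X\<close>.\<close>

lemma runs_change_oracle:
  "runs X D p n m \<Longrightarrow> D \<subseteq> D' \<Longrightarrow> (\<forall>i\<in>D. X i = X' i) \<Longrightarrow> runs X' D' p n m"
proof (induction rule: runs.induct)
  case (query n)
  then have "n \<in> D'" "X n = X' n" by blast+
  then show ?case using runs.query[of n D' X'] by simp
next
  case (mu p n k)
  show ?case
  proof (rule runs.mu)
    show "runs X' D' p (prod_encode (n, k)) 0" using mu by blast
    show "\<forall>j<k. \<exists>m>0. runs X' D' p (prod_encode (n, j)) m" using mu by blast
  qed
qed (blast intro: runs.zero runs.succ runs.fst runs.snd runs.pairing runs.comp runs.rec_0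
  runs.rec_Suc)+

lemma computable_imp_rec_in: "computable f \<Longrightarrow> rec_in X D f"
  unfolding computable_def rec_in_def phi_def
  using runs_change_oracle[of "\<lambda>_. False" "{}" _ _ _ D X] by blast

lemma runs_fst: "runs X D Fst n (pfst n)"
  using runs.fst[of X D "pfst n" "psnd n"] by simp

lemma runs_snd: "runs X D Snd n (psnd n)"
  using runs.snd[of X D "pfst n" "psnd n"] by simp

lemma runs_id: "runs X D (Pairing Fst Snd) n n"
  using runs.pairing[OF runs_fst[of X D n] runs_snd[of X D n]] by simp

named_theorems rec_intros

lemma rec_in_id [rec_intros]: "rec_in X D (\<lambda>x. x)"
  unfolding rec_in_def using runs_id by blast

lemma rec_in_comp:
  assumes "rec_in X D f" "rec_in X D g"
  shows "rec_in X D (\<lambda>x. f (g x))"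
  using assms unfolding rec_in_def by (meson runs.comp)

lemma rec_in_computable:
  assumes "computable f" "rec_in X D g"
  shows "rec_in X D (\<lambda>x. f (g x))"
  by (rule rec_in_comp[OF computable_imp_rec_in[OF assms(1)] assms(2)])

lemma rec_in_Suc [rec_intros]: "rec_in X D f \<Longrightarrow> rec_in X D (\<lambda>x. Suc (f x))"
  by (rule rec_in_comp) (auto simp: rec_in_def intro: runs.succ)

lemma rec_in_pfst [rec_intros]: "rec_in X D f \<Longrightarrow> rec_in X D (\<lambda>x. pfst (f x))"
  by (rule rec_in_comp[where f = pfst]) (auto simp: rec_in_def intro: runs_fst)

lemma rec_in_psnd [rec_intros]: "rec_in X D f \<Longrightarrow> rec_in X D (\<lambda>x. psnd (f x))"
  by (rule rec_in_comp[where f = psnd]) (auto simp: rec_in_def intro: runs_snd)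

lemma rec_in_const [rec_intros]: "rec_in X D (\<lambda>x. c)"
proof (induction c)
  case 0
  show ?case by (auto simp: rec_in_def intro: runs.zero)
next
  case (Suc c)
  then show ?case by (rule rec_in_Suc)
qed

lemma rec_in_prod_encode [rec_intros]:
  "rec_in X D f \<Longrightarrow> rec_in X D g \<Longrightarrow> rec_in X D (\<lambda>x. prod_encode (f x, g x))"
  unfolding rec_in_def by (meson runs.pairing)

lemma rec_in_oracle [rec_intros]: "rec_in X UNIV f \<Longrightarrow> rec_in X UNIV (\<lambda>x. of_bool (X (f x)))"
proof (rule rec_in_comp[where f = "\<lambda>n. of_bool (X n)"])
  show "rec_in X UNIV (\<lambda>n. of_bool (X n))" unfolding rec_in_def using runs.query by blast
qed

lemma rec_in_rec_nat [rec_intros]: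
  assumes "rec_in X D a" "rec_in X D (\<lambda>y. b (pfst y) (pfst (psnd y)) (psnd (psnd y)))" "rec_in X D n"
  shows "rec_in X D (\<lambda>x. rec_nat (a x) (\<lambda>k r. b x k r) (n x))"
proof -
  from assms obtain p q where p: "\<And>x. runs X D p x (a x)"
    and q: "\<And>y. runs X D q y (b (pfst y) (pfst (psnd y)) (psnd (psnd y)))"
    unfolding rec_in_def by blast
  have q': "runs X D q (prod_encode (x, prod_encode (k, r))) (b x k r)" for x k r
    using q[of "prod_encode (x, prod_encode (k, r))"] by simp
  have "runs X D (Rec p q) (prod_encode (x, k)) (rec_nat (a x) (b x) k)" for x k
    by (induction k) (auto intro: runs.rec_0 runs.rec_Suc p q')
  then have "runs X D (Rec p q) y (rec_nat (a (pfst y)) (b (pfst y)) (psnd y))" for y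
    by (metis prod.collapse prod_decode_inverse)
  then have "rec_in X D (\<lambda>y. rec_nat (a (pfst y)) (b (pfst y)) (psnd y))"
    unfolding rec_in_def by blast
  from rec_in_comp[OF this rec_in_prod_encode[OF rec_in_id assms(3)]] show ?thesis by simp
qed

text \<open>\<open>Mu\<close> searches for the output 0, hence the negated predicate.\<close>

lemma runs_Mu_Least:
  assumes p: "\<And>k. runs X D p (prod_encode (x, k)) (of_bool (\<not> P x k))" and "P x k"
  shows "runs X D (Mu p) x (LEAST k. P x k)"
proof (rule runs.mu)
  show "runs X D p (prod_encode (x, LEAST k. P x k)) 0"
    using p[of "LEAST k. P x k"] LeastI[of "P x", OF assms(2)] by simp
  show "\<forall>j<LEAST k. P x k. \<exists>m>0. runs X D p (prod_encode (x, j)) m"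
  proof (intro allI impI)
    fix j assume "j < (LEAST k. P x k)"
    then have "\<not> P x j" by (rule not_less_Least)
    then show "\<exists>m>0. runs X D p (prod_encode (x, j)) m" using p[of j] by auto
  qed
qed

lemma rec_in_Least [rec_intros]:
  assumes "\<And>x. \<exists>k. P x k" "rec_in X D (\<lambda>y. of_bool (P (pfst y) (psnd y)))"
  shows "rec_in X D (\<lambda>x. LEAST k. P x k)"
proof -
  have "rec_in X D (\<lambda>y. rec_nat 1 (\<lambda>k r. 0) (of_bool (P (pfst y) (psnd y))))"
    by (intro rec_intros assms)
  moreover have "rec_nat 1 (\<lambda>k r. 0) (of_bool Q) = of_bool (\<not> Q)" for Q by (cases Q) auto
  ultimately obtain p where p: "\<And>y. runs X D p y (of_bool (\<not> P (pfst y) (psnd y)))"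
    unfolding rec_in_def by metis
  have p': "runs X D p (prod_encode (x, k)) (of_bool (\<not> P x k))" for x k
    using p[of "prod_encode (x, k)"] by simp
  have "runs X D (Mu p) x (LEAST k. P x k)" for x
    using assms(1)[of x] p' by (blast intro: runs_Mu_Least)
  then show ?thesis unfolding rec_in_def by blast
qed

section \<open>Arithmetic and decidable predicates\<close>

lemma rec_in_add [rec_intros]:
  assumes "rec_in X D f" "rec_in X D g"
  shows "rec_in X D (\<lambda>x. f x + g x)"
proof -
  have "rec_in X D (\<lambda>x. rec_nat (f x) (\<lambda>k r. Suc r) (g x))" by (intro rec_intros assms)
  moreover have "rec_nat a (\<lambda>k r. Suc r) b = a + b" for a b by (induction b) auto
  ultimately show ?thesis by simp
qed

lemma rec_in_diff [rec_intros]: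
  assumes "rec_in X D f" "rec_in X D g"
  shows "rec_in X D (\<lambda>x. f x - g x)"
proof -
  have "rec_in X D (\<lambda>x. rec_nat (f x) (\<lambda>k r. rec_nat 0 (\<lambda>l s. l) r) (g x))"
    by (intro rec_intros assms)
  moreover have "rec_nat 0 (\<lambda>l s. l) r = r - 1" for r :: nat by (cases r) auto
  moreover have "rec_nat a (\<lambda>k r. r - 1) b = a - b" for a b :: nat by (induction b) auto
  ultimately show ?thesis by simp
qed

lemma rec_in_mult [rec_intros]:
  assumes "rec_in X D f" "rec_in X D g"
  shows "rec_in X D (\<lambda>x. f x * g x)"
proof -
  have "rec_in X D (\<lambda>x. rec_nat 0 (\<lambda>k r. r + f x) (g x))"
    by (intro rec_intros rec_in_comp[OF assms(1)] assms(2))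
  moreover have "rec_nat 0 (\<lambda>k r. r + a) b = a * b" for a b :: nat by (induction b) auto
  ultimately show ?thesis by simp
qed

lemma rec_in_power [rec_intros]:
  assumes "rec_in X D f" "rec_in X D g"
  shows "rec_in X D (\<lambda>x. f x ^ g x)"
proof -
  have "rec_in X D (\<lambda>x. rec_nat 1 (\<lambda>k r. r * f x) (g x))"
    by (intro rec_intros rec_in_comp[OF assms(1)] assms(2))
  moreover have "rec_nat 1 (\<lambda>k r. r * a) b = a ^ b" for a b :: nat by (induction b) auto
  ultimately show ?thesis by simp
qed

lemma rec_in_sum [rec_intros]:
  assumes "rec_in X D (\<lambda>y. F (pfst y) (psnd y))" "rec_in X D n"
  shows "rec_in X D (\<lambda>x. \<Sum>i<n x. F x i)"
proof -
  have "rec_in X D (\<lambda>y. F (pfst (prod_encode (pfst y, pfst (psnd y))))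
      (psnd (prod_encode (pfst y, pfst (psnd y)))))"
    by (rule rec_in_comp[OF assms(1)]) (intro rec_intros)
  then have "rec_in X D (\<lambda>y. F (pfst y) (pfst (psnd y)))" by simp
  then have "rec_in X D (\<lambda>x. rec_nat 0 (\<lambda>k r. r + F x k) (n x))" by (intro rec_intros assms)
  moreover have "rec_nat 0 (\<lambda>k r. r + F x k) b = (\<Sum>i<b. F x i)" for x b by (induction b) auto
  ultimately show ?thesis by simp
qed

lemma rec_in_If [rec_intros]:
  assumes "rec_in X D (\<lambda>x. of_bool (P x))" "rec_in X D f" "rec_in X D g"
  shows "rec_in X D (\<lambda>x. if P x then f x else g x)"
proof -
  have "rec_in X D (\<lambda>x. rec_nat (g x) (\<lambda>k r. f x) (of_bool (P x)))"
  proof (intro rec_in_rec_nat assms)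
    show "rec_in X D (\<lambda>y. f (pfst y))" by (intro rec_in_comp[OF assms(2)] rec_intros)
  qed
  moreover have "rec_nat (g x) (\<lambda>k r. f x) (of_bool (P x)) = (if P x then f x else g x)" for x
    by (cases "P x") auto
  ultimately show ?thesis by simp
qed

lemma of_bool_not_nat: "(of_bool (\<not> P) :: nat) = 1 - of_bool P"
  by (cases P) simp_all

lemma rec_in_not [rec_intros]:
  assumes "rec_in X D (\<lambda>x. of_bool (P x))"
  shows "rec_in X D (\<lambda>x. of_bool (\<not> P x))"
proof -
  have "rec_in X D (\<lambda>x. 1 - of_bool (P x))" by (intro rec_intros assms)
  then show ?thesis by (simp only: of_bool_not_nat)
qed

lemma rec_in_conj [rec_intros]:
  assumes "rec_in X D (\<lambda>x. of_bool (P x))" "rec_in X D (\<lambda>x. of_bool (Q x))"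
  shows "rec_in X D (\<lambda>x. of_bool (P x \<and> Q x))"
  using rec_in_mult[OF assms] by (simp only: of_bool_conj)

lemma rec_in_disj [rec_intros]:
  assumes "rec_in X D (\<lambda>x. of_bool (P x))" "rec_in X D (\<lambda>x. of_bool (Q x))"
  shows "rec_in X D (\<lambda>x. of_bool (P x \<or> Q x))"
  using rec_in_not[OF rec_in_conj[OF rec_in_not[OF assms(1)] rec_in_not[OF assms(2)]]] by simp

lemma rec_in_le [rec_intros]:
  assumes "rec_in X D f" "rec_in X D g"
  shows "rec_in X D (\<lambda>x. of_bool (f x \<le> g x))"
proof -
  have "rec_in X D (\<lambda>x. 1 - (f x - g x))" by (intro rec_intros assms)
  moreover have "1 - (a - b) = of_bool (a \<le> b)" for a b :: nat by (cases "a \<le> b") auto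
  ultimately show ?thesis by simp
qed

lemma rec_in_less [rec_intros]:
  assumes "rec_in X D f" "rec_in X D g"
  shows "rec_in X D (\<lambda>x. of_bool (f x < g x))"
  using rec_in_le[OF rec_in_Suc[OF assms(1)] assms(2)] by (simp add: Suc_le_eq)

lemma rec_in_eq [rec_intros]:
  assumes "rec_in X D f" "rec_in X D g"
  shows "rec_in X D (\<lambda>x. of_bool (f x = g x))"
  using rec_in_conj[OF rec_in_le[OF assms] rec_in_le[OF assms(2,1)]] by (simp only: order_eq_iff[symmetric])

lemma rec_in_all [rec_intros]:
  assumes "rec_in X D (\<lambda>y. of_bool (P (pfst y) (psnd y)))" "rec_in X D n"
  shows "rec_in X D (\<lambda>x. of_bool (\<forall>i<n x. P x i))"
proof -
  have "rec_in X D (\<lambda>x. of_bool ((\<Sum>i<n x. of_bool (\<not> P x i)) = (0::nat)))"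
    by (intro rec_intros assms)
  moreover have "(\<Sum>i<n x. of_bool (\<not> P x i)) = (0::nat) \<longleftrightarrow> (\<forall>i<n x. P x i)" for x
    by auto
  ultimately show ?thesis by simp
qed

lemma rec_in_div [rec_intros]:
  assumes "rec_in X D f" "rec_in X D g"
  shows "rec_in X D (\<lambda>x. f x div g x)"
proof -
  \<comment> \<open>The disjunct \<open>b = 0\<close> stops the search at 0, in agreement with the
    value of division by 0.\<close>
  have eq: "a div b = (LEAST k. b = 0 \<or> a < b * Suc k)" for a b :: nat
  proof (cases "b = 0")
    case False
    have "a < b * Suc (a div b)" using False dividend_less_times_div[of b a] by simp
    moreover have "a div b \<le> k" if "a < b * Suc k" for k
      using less_mult_imp_div_less[of a "Suc k" b] that by (simp only: mult.commute less_Suc_eq_le)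
    ultimately show ?thesis using False by (intro Least_equality[symmetric]) auto
  qed (simp add: Least_equality)
  have f: "rec_in X D (\<lambda>y. f (pfst y))" and g: "rec_in X D (\<lambda>y. g (pfst y))"
    by (intro rec_in_comp[OF assms(1)] rec_in_comp[OF assms(2)] rec_intros)+
  have ex: "\<exists>k. b = 0 \<or> a < b * Suc k" for a b :: nat
    using dividend_less_times_div[of b a] by (cases "b = 0") auto
  have "rec_in X D (\<lambda>x. LEAST k. g x = 0 \<or> f x < g x * Suc k)"
    by (rule rec_in_Least[OF ex]) (intro rec_intros f g)
  then show ?thesis by (simp only: eq)
qed

lemma rec_in_bit [rec_intros]:
  assumes "rec_in X D f" "rec_in X D g"
  shows "rec_in X D (\<lambda>x. of_bool (bit (f x) (g x)))"
proof -
  have "rec_in X D (\<lambda>x. f x div 2 ^ g x - 2 * (f x div 2 ^ g x div 2))"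
    by (intro rec_intros assms)
  moreover have "a div 2 ^ b - 2 * (a div 2 ^ b div 2) = of_bool (bit a b)" for a b :: nat
    by (simp add: bit_iff_odd of_bool_odd_eq_mod_2 minus_mult_div_eq_mod)
  ultimately show ?thesis by simp
qed

lemma rec_in_funpow:
  assumes "computable s" "rec_in X D f" "rec_in X D n"
  shows "rec_in X D (\<lambda>x. (s ^^ n x) (f x))"
proof -
  have "rec_in X D (\<lambda>x. rec_nat (f x) (\<lambda>k r. s r) (n x))"
    by (intro rec_intros assms rec_in_computable[OF assms(1)])
  moreover have "rec_nat a (\<lambda>k r. s r) b = (s ^^ b) a" for a b by (induction b) auto
  ultimately show ?thesis by simp
qed

section \<open>A clocked evaluator\<close>

text \<open>The oracle is given by the bits below \<open>u\<close> of the number \<open>z\<close>, and the clock \<open>t\<close> bounds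
  only the unbounded searches.  The value \<open>0\<close> stands for divergence and \<open>Suc m\<close> for the output \<open>m\<close>.\<close>

primrec ev :: "prog \<Rightarrow> nat \<Rightarrow> nat \<Rightarrow> nat \<Rightarrow> nat \<Rightarrow> nat" where
  "ev Zero u z n t = 1"
| "ev Succ u z n t = Suc (Suc n)"
| "ev Fst u z n t = Suc (pfst n)"
| "ev Snd u z n t = Suc (psnd n)"
| "ev Query u z n t = (if n < u then Suc (of_bool (bit z n)) else 0)"
| "ev (Pairing p q) u z n t = (if ev p u z n t = 0 \<or> ev q u z n t = 0 then 0
     else Suc (prod_encode (ev p u z n t - 1, ev q u z n t - 1)))"
| "ev (Comp p q) u z n t = (if ev q u z n t = 0 then 0 else ev p u z (ev q u z n t - 1) t)"
| "ev (Rec p q) u z n t = rec_nat (ev p u z (pfst n) t)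
     (\<lambda>k r. if r = 0 then 0 else ev q u z (prod_encode (pfst n, prod_encode (k, r - 1))) t) (psnd n)"
| "ev (Mu p) u z n t =
     (if (LEAST k. t \<le> k \<or> ev p u z (prod_encode (n, k)) t \<le> 1) < t \<and>
         ev p u z (prod_encode (n, LEAST k. t \<le> k \<or> ev p u z (prod_encode (n, k)) t \<le> 1)) t = 1
      then Suc (LEAST k. t \<le> k \<or> ev p u z (prod_encode (n, k)) t \<le> 1) else 0)"

lemma ev_Rec_Suc:
  "ev (Rec p q) u z (prod_encode (a, Suc k)) t =
     (if ev (Rec p q) u z (prod_encode (a, k)) t = 0 then 0
      else ev q u z (prod_encode (a, prod_encode (k, ev (Rec p q) u z (prod_encode (a, k)) t - 1))) t)"
  unfolding ev.simps prod_encode_inverse fst_conv snd_conv old.nat.rec(2) ..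

lemma ev_sound: "ev p u z n t = Suc m \<Longrightarrow> runs (bit z) {..<u} p n m"
proof (induction p arbitrary: n m)
  case Zero
  then show ?case by (auto intro: runs.zero)
next
  case Succ
  then show ?case by (auto intro: runs.succ)
next
  case Fst
  then show ?case by (auto intro: runs_fst)
next
  case Snd
  then show ?case by (auto intro: runs_snd)
next
  case Query
  then show ?case
    using runs.query[of n "{..<u}" "bit z"] by (auto split: if_splits)
next
  case (Pairing p q)
  then have "ev p u z n t = Suc (ev p u z n t - 1)" "ev q u z n t = Suc (ev q u z n t - 1)"
    "m = prod_encode (ev p u z n t - 1, ev q u z n t - 1)"
    by (auto split: if_splits)
  with Pairing.IH show ?case by (metis runs.pairing)
next
  case (Comp p q)
  then have "ev q u z n t = Suc (ev q u z n t - 1)" "ev p u z (ev q u z n t - 1) t = Suc m"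
    by (auto split: if_splits)
  with Comp.IH show ?case by (metis runs.comp)
next
  case (Rec p q)
  have "ev (Rec p q) u z (prod_encode (a, k)) t = Suc m \<Longrightarrow>
      runs (bit z) {..<u} (Rec p q) (prod_encode (a, k)) m" for a k m
  proof (induction k arbitrary: m)
    case 0
    then show ?case by (auto intro: runs.rec_0 Rec.IH(1))
  next
    case (Suc k)
    then obtain r where r: "ev (Rec p q) u z (prod_encode (a, k)) t = Suc r"
      "ev q u z (prod_encode (a, prod_encode (k, r))) t = Suc m"
      unfolding ev_Rec_Suc by (auto split: if_splits simp: gr0_conv_Suc simp del: ev.simps)
    then show ?case by (blast intro: runs.rec_Suc Suc.IH Rec.IH(2))
  qed
  from this[of "pfst n" "psnd n"] Rec.prems show ?case by (simp only: prod.collapse prod_decode_inverse)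
next
  case (Mu p)
  \<comment> \<open>The search stops at the clock, at divergence (value 0) or at output 0 (value 1).
    The tests in \<open>ev\<close> leave only the last case, and all earlier values exceed 1, so
    they are positive outputs.\<close>
  define k where "k = (LEAST k. t \<le> k \<or> ev p u z (prod_encode (n, k)) t \<le> 1)"
  from Mu.prems have k: "k < t" "ev p u z (prod_encode (n, k)) t = Suc 0" "m = k"
    by (simp_all add: k_def split: if_splits)
  show ?case unfolding \<open>m = k\<close>
  proof (rule runs.mu)
    show "runs (bit z) {..<u} p (prod_encode (n, k)) 0" by (rule Mu.IH[OF k(2)])
    show "\<forall>j<k. \<exists>m>0. runs (bit z) {..<u} p (prod_encode (n, j)) m"
    proof (intro allI impI)
      fix j assume "j < k"
      then have "\<not> ev p u z (prod_encode (n, j)) t \<le> 1"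
        unfolding k_def by (blast dest: not_less_Least)
      then have "ev p u z (prod_encode (n, j)) t = Suc (ev p u z (prod_encode (n, j)) t - 1)"
        "ev p u z (prod_encode (n, j)) t - 1 > 0" by auto
      then show "\<exists>m>0. runs (bit z) {..<u} p (prod_encode (n, j)) m" using Mu.IH by blast
    qed
  qed
qed

text \<open>Convergence is claimed for all large clocks, so that the finitely many subcomputations
  of a halting run converge at a common \<open>t\<close>.\<close>

lemma ev_complete:
  assumes "runs X {..<u} p n m" "\<forall>i<u. bit z i = X i"
  shows "\<forall>\<^sub>F t in sequentially. ev p u z n t = Suc m"
  using assms
proof (induction rule: runs.induct)
  case (pairing p n a q b)
  have "\<forall>\<^sub>F t in sequentially. ev p u z n t = Suc a" "\<forall>\<^sub>F t in sequentially. ev q u z n t = Suc b"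
    using pairing by blast+
  then show ?case by eventually_elim simp
next
  case (comp q n a p b)
  have "\<forall>\<^sub>F t in sequentially. ev q u z n t = Suc a" "\<forall>\<^sub>F t in sequentially. ev p u z a t = Suc b"
    using comp by blast+
  then show ?case by eventually_elim simp
next
  case (rec_Suc p q a k r b)
  have "\<forall>\<^sub>F t in sequentially. ev (Rec p q) u z (prod_encode (a, k)) t = Suc r"
    "\<forall>\<^sub>F t in sequentially. ev q u z (prod_encode (a, prod_encode (k, r))) t = Suc b"
    using rec_Suc by blast+
  then show ?case by eventually_elim (simp add: ev_Rec_Suc del: ev.simps)
next
  case (mu p n k)
  have "\<forall>\<^sub>F t in sequentially. ev p u z (prod_encode (n, j)) t > 1" if "j < k" for j
  proof -
    from mu that obtain m where "m > 0"
      "\<forall>\<^sub>F t in sequentially. ev p u z (prod_encode (n, j)) t = Suc m" by blast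
    then show ?thesis by (auto elim: eventually_mono)
  qed
  then have "\<forall>\<^sub>F t in sequentially. \<forall>j\<in>{..<k}. ev p u z (prod_encode (n, j)) t > 1"
    by (intro eventually_ball_finite) auto
  moreover have "\<forall>\<^sub>F t in sequentially. ev p u z (prod_encode (n, k)) t = Suc 0"
    using mu by blast
  moreover have "\<forall>\<^sub>F t in sequentially. k < t" by (rule eventually_gt_at_top)
  ultimately show ?case
  proof eventually_elim
    case (elim t)
    have "(LEAST k. t \<le> k \<or> ev p u z (prod_encode (n, k)) t \<le> 1) = k"
    proof (rule Least_equality)
      fix j assume j: "t \<le> j \<or> ev p u z (prod_encode (n, j)) t \<le> 1"
      show "k \<le> j"
      proof (rule ccontr)
        assume "\<not> k \<le> j"
        then have "j < k" by simp
        with elim(1) have "1 < ev p u z (prod_encode (n, j)) t" by (simp only: Ball_def lessThan_iff)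
        with j elim(3) \<open>j < k\<close> show False by linarith
      qed
    qed (use elim in simp)
    with elim show ?case by simp
  qed
qed simp_all

lemma ev_cong: "(\<And>i. i < u \<Longrightarrow> bit z i = bit z' i) \<Longrightarrow> ev p u z n t = ev p u z' n t"
proof (induction p arbitrary: n t)
  case (Rec p q)
  \<comment> \<open>The recursor calls the evaluator at varying inputs, so the induction hypotheses
    are first turned into equalities of functions.\<close>
  then have "ev p u z = ev p u z'" "ev q u z = ev q u z'" by (intro ext; blast)+
  then show ?case by (simp only: ev.simps)
qed simp_all

text \<open>The clock makes every search total, so each clause of \<open>ev\<close> falls under the
  closure rules. The arguments stay arbitrary because clauses evaluate subprograms at computed
  inputs.\<close>

lemma rec_in_ev:
  assumes "rec_in X D u" "rec_in X D z" "rec_in X D n" "rec_in X D t"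
  shows "rec_in X D (\<lambda>x. ev p (u x) (z x) (n x) (t x))"
  using assms
proof (induction p arbitrary: u z n t)
  case (Pairing p q)
  show ?case unfolding ev.simps by (intro rec_intros Pairing)
next
  case (Comp p q)
  show ?case unfolding ev.simps by (intro rec_intros Comp)
next
  case (Rec p q)
  show ?case unfolding ev.simps
    by (intro rec_intros Rec Rec.prems[THEN rec_in_comp])
next
  case (Mu p)
  have *: "rec_in X D (\<lambda>x. LEAST k. t x \<le> k \<or> ev p (u x) (z x) (prod_encode (n x, k)) (t x) \<le> 1)"
    by (rule rec_in_Least, blast) (intro rec_intros Mu.IH Mu.prems[THEN rec_in_comp])
  show ?case unfolding ev.simps
    by (intro rec_intros Mu *)
qed (unfold ev.simps, (intro rec_intros; assumption)+)

section \<open>Enumerable sets and partial functions\<close>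

inductive_cases runs_CompE: "runs X D (Comp p q) n m"
inductive_cases runs_MuE: "runs X D (Mu p) n m"
inductive_cases runs_PairingE: "runs X D (Pairing p q) n m"

text \<open>An unbounded search for \<open>k\<close> halts exactly when a witness exists.\<close>

lemma ce_projection:
  assumes "computable (\<lambda>y. of_bool (P (pfst y) (psnd y)))"
  shows "ce {x. \<exists>k. P x k}"
proof -
  from assms obtain p where "\<And>y. phi p y (of_bool (\<not> P (pfst y) (psnd y)))"
    unfolding computable_iff_rec_in by (drule_tac rec_in_not) (auto simp: rec_in_def phi_def)
  then have p: "runs (\<lambda>_. False) {} p (prod_encode (x, k)) (of_bool (\<not> P x k))" for x k
    by (metis fst_conv phi_def prod_encode_inverse snd_conv)
  have "(\<exists>m. phi (Mu p) x m) \<longleftrightarrow> (\<exists>k. P x k)" for x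
  proof
    assume "\<exists>m. phi (Mu p) x m"
    then obtain m where "runs (\<lambda>_. False) {} p (prod_encode (x, m)) 0"
      unfolding phi_def by (auto elim: runs_MuE)
    from runs_det[OF this p] show "\<exists>k. P x k" by (auto split: if_splits)
  next
    assume "\<exists>k. P x k"
    then show "\<exists>m. phi (Mu p) x m" unfolding phi_def by (blast intro: runs_Mu_Least p)
  qed
  then show ?thesis unfolding ce_def by (intro exI[of _ "Mu p"]) simp
qed

text \<open>The witness \<open>t\<close> is the clock of an evaluation without oracle bits,
  \<open>u = 0\<close> and \<open>z = 0\<close>.\<close>

lemma ce_imp_projection:
  assumes "ce W"
  obtains E where "computable E" "W = {x. \<exists>t. E (prod_encode (x, t)) \<noteq> 0}"
proof -
  from assms obtain p where p: "W = {n. \<exists>m. phi p n m}" unfolding ce_def by blast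
  have zero: "bit (0::nat) = (\<lambda>_. False)" by (intro ext) simp
  have "(\<exists>m. phi p n m) \<longleftrightarrow> (\<exists>t. ev p 0 0 n t \<noteq> 0)" for n
  proof
    assume "\<exists>m. phi p n m"
    then obtain m where "runs (\<lambda>_. False) {..<0} p n m" by (auto simp: phi_def)
    from ev_complete[OF this, of 0] have "\<forall>\<^sub>F t in sequentially. ev p 0 0 n t = Suc m" by simp
    then obtain t where "ev p 0 0 n t = Suc m" by (auto simp: eventually_sequentially)
    then show "\<exists>t. ev p 0 0 n t \<noteq> 0" by (intro exI[of _ t]) simp
  next
    assume "\<exists>t. ev p 0 0 n t \<noteq> 0"
    then obtain t m where "ev p 0 0 n t = Suc m" by (meson not0_implies_Suc)
    from ev_sound[OF this] show "\<exists>m. phi p n m" unfolding phi_def zero lessThan_0 by blast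
  qed
  then have "W = {x. \<exists>t. ev p 0 0 (pfst (prod_encode (x, t))) (psnd (prod_encode (x, t))) \<noteq> 0}"
    by (simp add: p)
  moreover have "computable (\<lambda>y. ev p 0 0 (pfst y) (psnd y))"
    unfolding computable_iff_rec_in by (intro rec_in_ev rec_intros)
  ultimately show thesis using that by blast
qed

text \<open>A total computation becomes partial by first running a search that halts precisely on
  \<open>P\<close>.\<close>

lemma partial_restriction:
  assumes "computable (\<lambda>x. of_bool (P x))" "computable f"
  obtains p where "\<And>x m. phi p x m \<longleftrightarrow> P x \<and> m = f x"
proof -
  have "rec_in (\<lambda>_. False) {} (\<lambda>y. of_bool (\<not> P (pfst y)))"
    by (rule rec_in_not, rule rec_in_computable[OF assms(1)], intro rec_intros)
  then obtain q where q: "\<And>y. runs (\<lambda>_. False) {} q y (of_bool (\<not> P (pfst y)))"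
    unfolding rec_in_def by blast
  have q': "runs (\<lambda>_. False) {} q (prod_encode (x, k)) (of_bool (\<not> P x))" for x k
    using q[of "prod_encode (x, k)"] by simp
  from assms(2) obtain r where r: "\<And>x. runs (\<lambda>_. False) {} r x (f x)"
    unfolding computable_def phi_def by blast
  \<comment> \<open>\<open>Mu q\<close> is run only for its halting: the pair keeps the input in
    front, and \<open>Fst\<close> discards the result of the search.\<close>
  define p where "p = Comp (Comp r Fst) (Pairing (Pairing Fst Snd) (Mu q))"
  have "phi p x m \<longleftrightarrow> P x \<and> m = f x" for x m
  proof
    assume "P x \<and> m = f x"
    moreover from this have "runs (\<lambda>_. False) {} (Mu q) x (LEAST k. P x)"
      using runs_Mu_Least[where P = "\<lambda>x k. P x", OF q'] by blast
    ultimately show "phi p x m"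
      unfolding p_def phi_def by (auto intro!: runs.comp runs.pairing runs_id runs.fst r)
  next
    assume "phi p x m"
    then obtain y where y: "runs (\<lambda>_. False) {} (Pairing (Pairing Fst Snd) (Mu q)) x y"
      "runs (\<lambda>_. False) {} (Comp r Fst) y m"
      unfolding p_def phi_def by (rule runs_CompE)
    from y(1) obtain a k where k: "runs (\<lambda>_. False) {} (Pairing Fst Snd) x a"
      "runs (\<lambda>_. False) {} (Mu q) x k" "y = prod_encode (a, k)"
      by (rule runs_PairingE)
    have "a = x" by (rule runs_det[OF k(1) runs_id])
    from k(2) have "runs (\<lambda>_. False) {} q (prod_encode (x, k)) 0" by (auto elim: runs_MuE)
    from runs_det[OF this q'] have "P x" by (auto split: if_splits)
    moreover have "runs (\<lambda>_. False) {} (Comp r Fst) (prod_encode (a, k)) (f a)"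
      by (intro runs.comp[OF runs.fst r])
    ultimately show "P x \<and> m = f x" using runs_det y(2) k(3) \<open>a = x\<close> by blast
  qed
  with that show thesis by blast
qed

section \<open>Strings as numbers\<close>

text \<open>Tail, entries and length of a list code.  Past the end of the list, tails and entries are \<open>0\<close>
  because \<open>prod_decode 0 = (0, 0)\<close>.\<close>

definition ctl :: "nat \<Rightarrow> nat" where "ctl c = psnd (c - 1)"
definition cnth :: "nat \<Rightarrow> nat \<Rightarrow> nat" where "cnth c i = pfst ((ctl ^^ i) c - 1)"
definition clen :: "nat \<Rightarrow> nat" where "clen c = (LEAST i. (ctl ^^ i) c = 0)"

lemma prod_decode_0: "prod_decode 0 = (0, 0)"
  by (simp add: prod_decode_def prod_decode_aux.simps)

lemma ctl_list_encode: "ctl (list_encode xs) = list_encode (tl xs)"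
  by (cases xs) (simp_all add: ctl_def prod_decode_0)

lemma funpow_ctl_list_encode: "(ctl ^^ i) (list_encode xs) = list_encode (drop i xs)"
  by (induction i) (simp_all add: ctl_list_encode drop_Suc tl_drop)

lemma cnth_list_encode: "cnth (list_encode xs) i = (if i < length xs then xs ! i else 0)"
  unfolding cnth_def funpow_ctl_list_encode
  by (cases "drop i xs")
    (auto simp: prod_decode_0 hd_drop_conv_nth[symmetric] not_less dest: drop_eq_Nil[THEN iffD1])

lemma list_encode_eq_0_iff: "list_encode xs = 0 \<longleftrightarrow> xs = []"
  by (cases xs) simp_all

lemma clen_list_encode: "clen (list_encode xs) = length xs"
  unfolding clen_def funpow_ctl_list_encode list_encode_eq_0_iff by (intro Least_equality) auto

lemma cnth_str_code: "cnth (str_code \<sigma>) i = of_bool (i < length \<sigma> \<and> \<sigma> ! i)"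
  by (simp add: str_code_def cnth_list_encode)

lemma clen_str_code: "clen (str_code \<sigma>) = length \<sigma>"
  by (simp add: str_code_def clen_list_encode)

text \<open>Every number codes a list of numbers, so coding a binary string is a decidable condition
  on the entries.\<close>

lemma ex_str_code_iff: "(\<exists>\<sigma>. c = str_code \<sigma>) \<longleftrightarrow> (\<forall>i<clen c. cnth c i \<le> 1)"
proof
  assume *: "\<forall>i<clen c. cnth c i \<le> 1"
  obtain xs where c: "c = list_encode xs" by (metis list_decode_inverse)
  have "xs = map of_bool (map (\<lambda>x. x = 1) xs)"
    using * by (intro nth_equalityI) (auto simp: c clen_list_encode cnth_list_encode le_Suc_eq)
  then show "\<exists>\<sigma>. c = str_code \<sigma>" unfolding c str_code_def by metis
qed (auto simp: clen_str_code cnth_str_code)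

lemma computable_ctl: "computable ctl"
  unfolding computable_iff_rec_in ctl_def by (intro rec_intros)

lemma rec_in_cnth [rec_intros]:
  "rec_in X D f \<Longrightarrow> rec_in X D g \<Longrightarrow> rec_in X D (\<lambda>x. cnth (f x) (g x))"
  unfolding cnth_def by (intro rec_intros rec_in_funpow[OF computable_ctl])

lemma rec_in_clen [rec_intros]:
  assumes "rec_in X D f"
  shows "rec_in X D (\<lambda>x. clen (f x))"
proof -
  have "\<exists>i. (ctl ^^ i) c = 0" for c
    by (metis funpow_ctl_list_encode list_decode_inverse drop_all order_refl list_encode_eq_0_iff)
  then show ?thesis unfolding clen_def
    by (rule rec_in_Least) (intro rec_intros rec_in_funpow[OF computable_ctl] rec_in_comp[OF assms])
qed

text \<open>Least significant bit first, so that \<open>bit\<close> reads it back: the form in which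
  \<open>ev\<close> receives a finite oracle.\<close>

definition seg :: "(nat \<Rightarrow> bool) \<Rightarrow> nat \<Rightarrow> nat" where
  "seg X n = (\<Sum>i<n. of_bool (X i) * 2 ^ i)"

lemma bit_seg: "bit (seg X n) i \<longleftrightarrow> i < n \<and> X i"
proof -
  have "seg X n = horner_sum of_bool 2 (map X [0..<n])"
    by (simp add: seg_def horner_sum_eq_sum atLeast0LessThan)
  then show ?thesis by (auto simp: bit_horner_sum_bit_iff)
qed

lemma seg_less: "seg X n < 2 ^ n"
proof -
  have "take_bit n (seg X n) = seg X n" by (intro bit_eqI) (auto simp: bit_take_bit_iff bit_seg)
  then show ?thesis by (simp only: take_bit_nat_eq_self_iff)
qed

lemma seg_eq_iff: "seg X n = z \<longleftrightarrow> z < 2 ^ n \<and> (\<forall>i<n. X i = bit z i)"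
proof
  assume *: "z < 2 ^ n \<and> (\<forall>i<n. X i = bit z i)"
  then have "take_bit n z = z" by (simp add: take_bit_nat_eq_self)
  then show "seg X n = z" using * by (metis bit_eqI bit_seg bit_take_bit_iff)
qed (auto simp: seg_less bit_seg)

text \<open>Converts the list codes that enumerate cylinders into the binary numbers that serve as
  oracles.\<close>

definition cnum :: "nat \<Rightarrow> nat" where
  "cnum c = (\<Sum>i<clen c. cnth c i * 2 ^ i)"

lemma cnum_str_code: "X \<in> cylinder \<tau> \<Longrightarrow> cnum (str_code \<tau>) = seg X (length \<tau>)"
  unfolding cnum_def seg_def clen_str_code cnth_str_code cylinder_Int
  by (intro sum.cong) auto

lemma rec_in_cnum [rec_intros]:
  assumes "rec_in X D f"
  shows "rec_in X D (\<lambda>x. cnum (f x))"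
  unfolding cnum_def by (intro rec_intros rec_in_comp[OF assms])

section \<open>Lebesgue measure of events decided by finitely many bits\<close>

lemma seg_cylinder: "z < 2 ^ n \<Longrightarrow> {X. seg X n = z} = cylinder (map (bit z) [0..<n])"
  by (auto simp: cylinder_Int seg_eq_iff)

lemma seg_Collect: "{X. P (seg X n)} = (\<Union>z\<in>{z. z < 2 ^ n \<and> P z}. cylinder (map (bit z) [0..<n]))"
  by (auto simp: seg_less simp flip: seg_cylinder)

lemma sets_lebesgue_cantor: "sets lebesgue_cantor = sets borel"
  using cantor_prob_lebesgue by (simp add: cantor_prob_def)

lemma space_lebesgue_cantor: "space lebesgue_cantor = UNIV"
  using sets_eq_imp_space_eq[OF sets_lebesgue_cantor] by simp

lemma sets_seg_Collect: "{X. P (seg X n)} \<in> sets lebesgue_cantor"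
  unfolding seg_Collect sets_lebesgue_cantor
  by (intro borel_open open_UN ballI open_cylinder)

text \<open>The event is a disjoint union of cylinders of length \<open>n\<close>, one for each
  admissible \<open>z\<close>.\<close>

lemma measure_seg_Collect:
  "measure lebesgue_cantor {X. P (seg X n)} = card {z. z < 2 ^ n \<and> P z} / 2 ^ n"
proof -
  interpret prob_space lebesgue_cantor using cantor_prob_lebesgue by (simp add: cantor_prob_def)
  let ?S = "{z. z < 2 ^ n \<and> P z}" and ?A = "\<lambda>z. cylinder (map (bit z) [0..<n])"
  have "measure lebesgue_cantor (\<Union>z\<in>?S. ?A z) = (\<Sum>z\<in>?S. measure lebesgue_cantor (?A z))"
  proof (rule finite_measure_finite_Union)
    show "disjoint_family_on ?A ?S"
      by (auto simp: disjoint_family_on_def simp flip: seg_cylinder)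
  qed (auto simp: sets_lebesgue_cantor intro!: borel_open open_cylinder)
  then show ?thesis unfolding seg_Collect by (simp add: measure_lebesgue_cylinder power_one_over)
qed

section \<open>Total functionals with computable use\<close>

text \<open>\<open>B z s\<close> is the output bit \<open>s\<close> on an oracle whose bits below \<open>N s\<close> are those of the number \<open>z\<close>.\<close>

locale tt_functional =
  fixes N :: "nat \<Rightarrow> nat" and B :: "nat \<Rightarrow> nat \<Rightarrow> bool"
  assumes computable_N: "computable N"
    and computable_B: "computable (\<lambda>y. of_bool (B (pfst y) (psnd y)))"
    and B_cong: "\<And>z z' s. (\<And>i. i < N s \<Longrightarrow> bit z i = bit z' i) \<Longrightarrow> B z s = B z' s"
begin

definition Phi :: "(nat \<Rightarrow> bool) \<Rightarrow> nat \<Rightarrow> bool" where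
  "Phi X s = B (seg X (N s)) s"

text \<open>A sum in place of a maximum: it bounds every single use and is computable by the rule
  for sums.\<close>

definition total_use :: "nat \<Rightarrow> nat" where
  "total_use l = (\<Sum>s<l. N s)"

lemma N_le_total_use: "s < l \<Longrightarrow> N s \<le> total_use l"
  unfolding total_use_def by (intro member_le_sum) auto

lemma Phi_eq: "N s \<le> n \<Longrightarrow> Phi X s = B (seg X n) s"
  unfolding Phi_def by (intro B_cong) (auto simp: bit_seg)

lemma rec_in_N: "rec_in X D f \<Longrightarrow> rec_in X D (\<lambda>x. N (f x))"
  by (rule rec_in_computable[OF computable_N])

lemma rec_in_B: "rec_in X D f \<Longrightarrow> rec_in X D g \<Longrightarrow> rec_in X D (\<lambda>x. of_bool (B (f x) (g x)))"
  using rec_in_computable[OF computable_B rec_in_prod_encode] by simp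

lemma rec_in_total_use: "rec_in X D f \<Longrightarrow> rec_in X D (\<lambda>x. total_use (f x))"
  unfolding total_use_def by (intro rec_intros rec_in_N)

lemma Phi_in_cylinder:
  assumes "total_use (length \<sigma>) \<le> n"
  shows "Phi X \<in> cylinder \<sigma> \<longleftrightarrow> (\<forall>s<length \<sigma>. B (seg X n) s = \<sigma> ! s)"
proof -
  have "Phi X s = B (seg X n) s" if "s < length \<sigma>" for s
    using Phi_eq[OF order_trans[OF N_le_total_use[OF that] assms]] .
  then show ?thesis unfolding cylinder_Int by auto
qed

lemma turing_le_Phi: "turing_le (Phi X) X"
  unfolding turing_le_def computable_from_iff_rec_in Phi_def seg_def
  by (intro rec_in_B rec_intros rec_in_N)

text \<open>Each output bit depends on finitely many input bits, and the Borel sets are those of the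
  product sigma-algebra.\<close>

lemma measurable_Phi: "Phi \<in> measurable lebesgue_cantor borel"
proof -
  have "(\<lambda>X. Phi X s) \<in> measurable lebesgue_cantor (borel :: bool measure)" for s
  proof -
    have "Measurable.pred lebesgue_cantor (\<lambda>X. Phi X s)"
      unfolding pred_def space_lebesgue_cantor Phi_def using sets_seg_Collect by simp
    moreover have "sets (borel :: bool measure) = UNIV"
      by (auto intro: borel_open Topological_Spaces.open_discrete)
    ultimately show ?thesis by (subst measurable_cong_sets[OF refl, of _ "count_space UNIV"]) auto
  qed
  then have "Phi \<in> measurable lebesgue_cantor (PiM UNIV (\<lambda>_. borel))"
    by (intro measurable_PiM_single') (auto simp: space_PiM)
  then show ?thesis by (simp add: measurable_cong_sets[OF refl sets_PiM_equal_borel])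
qed

section \<open>The image of Lebesgue measure under the functional\<close>

definition pushforward :: "(nat \<Rightarrow> bool) measure" where
  "pushforward = distr lebesgue_cantor borel Phi"

lemma measure_pushforward:
  "A \<in> sets borel \<Longrightarrow> measure pushforward A = measure lebesgue_cantor (Phi -` A)"
  unfolding pushforward_def by (simp add: measure_distr[OF measurable_Phi] space_lebesgue_cantor)

text \<open>Numerator of the measure of the preimage of the cylinder coded by \<open>c\<close>, over
  the denominator \<open>2 ^ total_use (clen c)\<close>.\<close>

definition cyl_count :: "nat \<Rightarrow> nat" where
  "cyl_count c = (\<Sum>z<2 ^ total_use (clen c). of_bool (\<forall>s<clen c. of_bool (B z s) = cnth c s))"

lemma measure_pushforward_cylinder:
  "measure pushforward (cylinder \<sigma>) = cyl_count (str_code \<sigma>) / 2 ^ total_use (length \<sigma>)"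
proof -
  let ?n = "total_use (length \<sigma>)"
  have "Phi -` cylinder \<sigma> = {X. \<forall>s<length \<sigma>. B (seg X ?n) s = \<sigma> ! s}"
    by (simp add: vimage_def Phi_in_cylinder[OF order_refl])
  moreover have "cyl_count (str_code \<sigma>) = card {z. z < 2 ^ ?n \<and> (\<forall>s<length \<sigma>. B z s = \<sigma> ! s)}"
  proof -
    have "(\<forall>s<length \<sigma>. of_bool (B z s) = cnth (str_code \<sigma>) s) \<longleftrightarrow> (\<forall>s<length \<sigma>. B z s = \<sigma> ! s)" for z
      by (simp only: cnth_str_code of_bool_eq_iff) blast
    then show ?thesis unfolding cyl_count_def clen_str_code by (simp add: Int_def lessThan_def)
  qed
  ultimately show ?thesis
    by (simp add: measure_pushforward borel_open open_cylinder
        measure_seg_Collect[of "\<lambda>z. \<forall>s<length \<sigma>. B z s = \<sigma> ! s"])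
qed

lemma computable_measure_pushforward: "computable_measure pushforward"
proof -
  interpret prob_space lebesgue_cantor using cantor_prob_lebesgue by (simp add: cantor_prob_def)
  have "cantor_prob pushforward"
    unfolding cantor_prob_def pushforward_def by (simp add: prob_space_distr measurable_Phi)
  moreover have "computable_real_fun (\<lambda>\<sigma>. measure pushforward (cylinder \<sigma>))"
    unfolding computable_real_fun_def
  proof (intro exI conjI allI)
    \<comment> \<open>The measures are exact dyadic rationals, so one answer serves every precision.
      The factors 2 come from the coding of integers, where even numbers stand for the nonnegative
      ones.\<close>
    let ?q = "\<lambda>y. prod_encode (2 * cyl_count (pfst y), 2 * 2 ^ total_use (clen (pfst y)))"
    show "computable ?q"
      unfolding computable_iff_rec_in cyl_count_def
      by (intro rec_intros rec_in_B rec_in_total_use)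
    have "nat_to_rat_surj (prod_encode (2 * a, 2 * b)) = Fract (int a) (int b)" for a b
      by (simp add: nat_to_rat_surj_def int_decode_def sum_decode_def)
    then show "\<bar>measure pushforward (cylinder \<sigma>) -
        of_rat (nat_to_rat_surj (?q (prod_encode (str_code \<sigma>, k))))\<bar> \<le> (1/2) ^ k" for \<sigma> k
      by (simp add: measure_pushforward_cylinder clen_str_code of_rat_rat)
  qed
  ultimately show ?thesis by (simp add: computable_measure_def)
qed

text \<open>A string \<tau> is enumerated when it is long enough to determine the first
  \<open>length \<sigma>\<close> output bits for some enumerated \<sigma>, and these bits spell
  \<sigma>.\<close>

lemma uniformly_sigma01_vimage:
  assumes "uniformly_sigma01 V"
  shows "uniformly_sigma01 (\<lambda>i. Phi -` V i)"
proof -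
  from assms obtain W where W: "ce W"
    "\<And>i. V i = (\<Union>\<sigma>\<in>{\<sigma>. prod_encode (i, str_code \<sigma>) \<in> W}. cylinder \<sigma>)"
    unfolding uniformly_sigma01_def by blast
  from ce_imp_projection[OF W(1)] obtain E where E: "computable E"
    "W = {x. \<exists>t. E (prod_encode (x, t)) \<noteq> 0}" .
  \<comment> \<open>The witness \<open>k\<close> pairs a candidate code of \<sigma> with a stage of
    the enumeration; the test on entries excludes codes of non-binary lists.\<close>
  define P where "P y k \<longleftrightarrow> E (prod_encode (prod_encode (pfst y, pfst k), psnd k)) \<noteq> 0 \<and>
      (\<forall>i<clen (pfst k). cnth (pfst k) i \<le> 1) \<and> total_use (clen (pfst k)) \<le> clen (psnd y) \<and>
      (\<forall>s<clen (pfst k). of_bool (B (cnum (psnd y)) s) = cnth (pfst k) s)" for y k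
  have "computable (\<lambda>y. of_bool (P (pfst y) (psnd y)))"
    unfolding computable_iff_rec_in P_def
    by (intro rec_intros rec_in_B rec_in_total_use rec_in_computable[OF E(1)])
  then have "ce {y. \<exists>k. P y k}" by (rule ce_projection)
  moreover have P: "(\<exists>k. P (prod_encode (i, str_code \<tau>)) k) \<longleftrightarrow>
      (\<exists>\<sigma>. prod_encode (i, str_code \<sigma>) \<in> W \<and> total_use (length \<sigma>) \<le> length \<tau> \<and>
        (\<forall>s<length \<sigma>. B (cnum (str_code \<tau>)) s = \<sigma> ! s))" (is "?L \<longleftrightarrow> ?R") for i \<tau>
  proof
    assume ?L
    then obtain k where k: "P (prod_encode (i, str_code \<tau>)) k" ..
    then obtain \<sigma> where "pfst k = str_code \<sigma>" using ex_str_code_iff[of "pfst k"] by (auto simp: P_def)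
    with k show ?R by (auto simp: P_def E(2) clen_str_code cnth_str_code of_bool_eq_iff intro!: exI[of _ \<sigma>])
  next
    assume ?R
    then obtain \<sigma> t where "E (prod_encode (prod_encode (i, str_code \<sigma>), t)) \<noteq> 0"
      "total_use (length \<sigma>) \<le> length \<tau>" "\<forall>s<length \<sigma>. B (cnum (str_code \<tau>)) s = \<sigma> ! s"
      by (auto simp: E(2))
    then have "P (prod_encode (i, str_code \<tau>)) (prod_encode (str_code \<sigma>, t))"
      by (auto simp: P_def clen_str_code cnth_str_code)
    then show ?L ..
  qed
  have "Phi -` V i = (\<Union>\<tau>\<in>{\<tau>. prod_encode (i, str_code \<tau>) \<in> {y. \<exists>k. P y k}}. cylinder \<tau>)" for i
  proof (intro set_eqI iffI)
    fix X assume "X \<in> Phi -` V i"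
    then obtain \<sigma> where \<sigma>: "prod_encode (i, str_code \<sigma>) \<in> W" "Phi X \<in> cylinder \<sigma>"
      by (auto simp: W(2))
    define \<tau> where "\<tau> = init_seg X (total_use (length \<sigma>))"
    have \<tau>: "X \<in> cylinder \<tau>" "length \<tau> = total_use (length \<sigma>)"
      by (simp_all add: \<tau>_def cylinder_def init_seg_def)
    moreover have "\<forall>s<length \<sigma>. B (seg X (length \<tau>)) s = \<sigma> ! s"
      using Phi_in_cylinder[of \<sigma> "length \<tau>" X] \<sigma>(2) \<tau>(2) by simp
    ultimately have "\<exists>k. P (prod_encode (i, str_code \<tau>)) k"
      unfolding P cnum_str_code[OF \<tau>(1)] using \<sigma>(1) by (intro exI[of _ \<sigma>]) simp
    with \<tau> show "X \<in> (\<Union>\<tau>\<in>{\<tau>. prod_encode (i, str_code \<tau>) \<in> {y. \<exists>k. P y k}}. cylinder \<tau>)"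
      by blast
  next
    fix X assume "X \<in> (\<Union>\<tau>\<in>{\<tau>. prod_encode (i, str_code \<tau>) \<in> {y. \<exists>k. P y k}}. cylinder \<tau>)"
    then obtain \<tau> \<sigma> where "X \<in> cylinder \<tau>" "prod_encode (i, str_code \<sigma>) \<in> W"
      "total_use (length \<sigma>) \<le> length \<tau>" "\<forall>s<length \<sigma>. B (cnum (str_code \<tau>)) s = \<sigma> ! s"
      by (auto simp: P)
    then show "X \<in> Phi -` V i" by (auto simp: W(2) cnum_str_code Phi_in_cylinder)
  qed
  ultimately show ?thesis unfolding uniformly_sigma01_def by blast
qed

text \<open>A test for the image measure capturing \<open>Phi X\<close> pulls back to a Lebesgue
  test capturing \<open>X\<close>, with the same measures.\<close>

lemma proper_Phi:
  assumes "martin_loef_random lebesgue_cantor X"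
  shows "proper (Phi X)"
proof -
  have "martin_loef_random pushforward (Phi X)"
    unfolding martin_loef_random_def
  proof (intro allI impI)
    fix V assume V: "martin_loef_test pushforward V"
    then have sigma: "uniformly_sigma01 V" by (simp add: martin_loef_test_def)
    then have "open (V i)" for i
      unfolding uniformly_sigma01_def by (auto intro!: open_UN open_cylinder)
    with V sigma have "martin_loef_test lebesgue_cantor (\<lambda>i. Phi -` V i)"
      by (simp add: martin_loef_test_def uniformly_sigma01_vimage borel_open
          flip: measure_pushforward)
    with assms show "Phi X \<notin> (\<Inter>i. V i)" by (auto simp: martin_loef_random_def)
  qed
  with computable_measure_pushforward show ?thesis unfolding proper_def by blast
qed

end

section \<open>Anti-complexity\<close>

lemma rec_in_str_code:
  assumes "rec_in X D (\<lambda>y. of_bool (P (pfst y) (psnd y)))" "rec_in X D n"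
  shows "rec_in X D (\<lambda>x. str_code (map (P x) [0..<n x]))"
proof -
  \<comment> \<open>List codes grow at the head, so the recursion prepends entries from the last
    index downwards.\<close>
  let ?F = "\<lambda>x. rec_nat 0 (\<lambda>k r. Suc (prod_encode (of_bool (P x (n x - Suc k)), r)))"
  have "rec_in X D (\<lambda>y. of_bool (P (pfst (prod_encode (pfst y, n (pfst y) - Suc (pfst (psnd y)))))
      (psnd (prod_encode (pfst y, n (pfst y) - Suc (pfst (psnd y)))))))"
    by (rule rec_in_comp[OF assms(1)]) (intro rec_intros rec_in_comp[OF assms(2)])
  then have "rec_in X D (\<lambda>y. of_bool (P (pfst y) (n (pfst y) - Suc (pfst (psnd y)))))" by simp
  then have "rec_in X D (\<lambda>x. ?F x (n x))" by (intro rec_intros assms(2))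
  moreover have "k \<le> n x \<Longrightarrow> ?F x k = str_code (map (P x) [n x - k..<n x])" for x k
  proof (induction k)
    case (Suc k)
    then have "[n x - Suc k..<n x] = (n x - Suc k) # [n x - k..<n x]"
      by (subst upt_conv_Cons) (auto simp: Suc_diff_Suc)
    with Suc show ?case by (simp add: str_code_def)
  qed (simp add: str_code_def)
  ultimately show ?thesis by simp
qed

text \<open>A description \<open>1\<^sup>a 0 b \<rho>\<close> with \<open>\<bar>\<rho>\<bar> = a div 2\<close> stands for the number \<open>n = 2 a + b\<close>
  together with the first \<open>n div 4\<close> bits \<open>\<rho>\<close> of an oracle; its length is about \<open>3 n / 4\<close>.\<close>

definition lead :: "nat \<Rightarrow> nat" where
  "lead c = (LEAST i. cnth c i \<noteq> 1)"

definition well_formed :: "nat \<Rightarrow> bool" where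
  "well_formed c \<longleftrightarrow> clen c = lead c + 2 + lead c div 2"

definition index :: "nat \<Rightarrow> nat" where
  "index c = 2 * lead c + cnth c (Suc (lead c))"

definition payload :: "nat \<Rightarrow> nat" where
  "payload c = (\<Sum>i<lead c div 2. cnth c (lead c + 2 + i) * 2 ^ i)"

definition description :: "(nat \<Rightarrow> bool) \<Rightarrow> nat \<Rightarrow> bool list" where
  "description X n = replicate (n div 2) True @ [False, odd n] @ map X [0..<n div 4]"

lemma lead_eqI: "cnth c a \<noteq> 1 \<Longrightarrow> (\<And>i. i < a \<Longrightarrow> cnth c i = 1) \<Longrightarrow> lead c = a"
  unfolding lead_def by (rule Least_equality) (auto simp: not_less[symmetric])

text \<open>Entries past the end of a list are 0, so the block of leading ones is finite for every
  number.\<close>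

lemma cnth_lead: "cnth c (lead c) \<noteq> 1" and cnth_less_lead: "i < lead c \<Longrightarrow> cnth c i = 1"
proof -
  obtain xs where "c = list_encode xs" by (metis list_decode_inverse)
  then have "cnth c (length xs) \<noteq> 1" by (simp add: cnth_list_encode)
  then show "cnth c (lead c) \<noteq> 1" unfolding lead_def by (rule LeastI)
  show "i < lead c \<Longrightarrow> cnth c i = 1" unfolding lead_def using not_less_Least by blast
qed

lemma rec_in_lead: "rec_in X D f \<Longrightarrow> rec_in X D (\<lambda>x. lead (f x))"
  unfolding lead_def
proof (rule rec_in_Least)
  show "\<exists>i. cnth (f x) i \<noteq> 1" for x using cnth_lead by blast
  show "rec_in X D (\<lambda>y. of_bool (cnth (f (pfst y)) (psnd y) \<noteq> 1))" if "rec_in X D f"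
    by (intro rec_intros rec_in_comp[OF that])
qed

text \<open>The block of ones and its terminator are visible in the shorter string and fix the total
  length, so the format is self-delimiting.\<close>

lemma well_formed_prefix:
  assumes "prefix \<sigma> \<tau>" "well_formed (str_code \<sigma>)" "well_formed (str_code \<tau>)"
  shows "\<sigma> = \<tau>"
proof -
  define a where "a = lead (str_code \<sigma>)"
  have len: "length \<sigma> = a + 2 + a div 2"
    using assms(2) by (simp add: well_formed_def a_def clen_str_code)
  have eq: "cnth (str_code \<tau>) i = cnth (str_code \<sigma>) i" if "i \<le> a" for i
  proof -
    have "i < length \<sigma>" using that len by linarith
    then show ?thesis using assms(1) by (auto simp: prefix_def cnth_str_code nth_append)
  qed
  have "lead (str_code \<tau>) = a"
  proof (rule lead_eqI)
    show "cnth (str_code \<tau>) a \<noteq> 1"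
      using cnth_lead[of "str_code \<sigma>"] eq[OF order_refl] by (simp add: a_def)
    show "cnth (str_code \<tau>) i = 1" if "i < a" for i
      using eq[of i] cnth_less_lead[of i "str_code \<sigma>"] that by (simp add: a_def)
  qed
  with assms(3) len have "length \<tau> = length \<sigma>" by (simp add: well_formed_def clen_str_code)
  with assms(1) show ?thesis by (auto simp: prefix_def)
qed

lemma description:
  fixes X n
  defines "c \<equiv> str_code (description X n)"
  shows "well_formed c" "index c = n" "payload c = seg X (n div 4)" "lead c div 2 = n div 4"
proof -
  have 4: "n div 2 div 2 = n div 4" by (simp add: div_mult2_eq[symmetric])
  have nth: "description X n ! i = (if i < n div 2 then True else if i = n div 2 then False
      else if i = Suc (n div 2) then odd n else X (i - (n div 2 + 2)))"
    if "i < length (description X n)" for i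
    using that by (auto simp: description_def nth_append nth_Cons')
  have len: "length (description X n) = n div 2 + 2 + n div 4" by (simp add: description_def)
  have lead: "lead c = n div 2"
    unfolding c_def by (rule lead_eqI) (simp_all add: cnth_str_code nth len)
  then show "lead c div 2 = n div 4" using 4 by simp
  show "well_formed c" unfolding well_formed_def lead 4 by (simp add: c_def clen_str_code len)
  show "index c = n" unfolding index_def lead by (simp add: c_def cnth_str_code nth len)
  show "payload c = seg X (n div 4)" unfolding payload_def lead 4 seg_def
    by (intro sum.cong) (simp_all add: c_def cnth_str_code nth len)
qed

lemma K_le: "U \<rho> = Some \<tau> \<Longrightarrow> K U \<tau> \<le> length \<rho>"
  unfolding K_def by (rule Least_le) blast

section \<open>The machine that decodes descriptions\<close>

context tt_functional
begin

text \<open>Bits whose use exceeds the payload default to 0. This is correct as long as all elements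
  of \<open>Phi X\<close> below \<open>h (index c)\<close> have their use within the
  payload.\<close>

definition decode :: "(nat \<Rightarrow> nat) \<Rightarrow> nat \<Rightarrow> bool list" where
  "decode h c = map (\<lambda>s. N s \<le> lead c div 2 \<and> B (payload c) s) [0..<h (index c)]"

definition machine :: "(nat \<Rightarrow> nat) \<Rightarrow> bool list \<Rightarrow> bool list option" where
  "machine h \<sigma> = (if well_formed (str_code \<sigma>) then Some (decode h (str_code \<sigma>)) else None)"

text \<open>The machine restricts a total computable function to the decidable, prefix-free set of
  well-formed codes.\<close>

lemma prefix_free_machine_machine:
  assumes "computable h"
  shows "prefix_free_machine (machine h)"
  unfolding prefix_free_machine_def
proof
  have 1: "computable (\<lambda>c. of_bool (well_formed c))"
    unfolding computable_iff_rec_in well_formed_def by (intro rec_intros rec_in_lead)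
  have 2: "computable (\<lambda>c. str_code (decode h c))"
    unfolding computable_iff_rec_in decode_def index_def payload_def
    by (intro rec_in_str_code rec_intros rec_in_lead rec_in_N rec_in_B rec_in_computable[OF assms])
  from partial_restriction[OF 1 2]
  obtain p where "\<And>x m. phi p x m \<longleftrightarrow> well_formed x \<and> m = str_code (decode h x)" by blast
  then show "partial_computable_str (machine h)"
    unfolding partial_computable_str_def machine_def by (intro exI[of _ p]) auto
  show "\<forall>\<sigma>\<in>dom (machine h). \<forall>\<tau>\<in>dom (machine h). \<not> strict_prefix \<sigma> \<tau>"
    using well_formed_prefix by (auto simp: machine_def strict_prefix_def split: if_splits)
qed

lemma machine_description:
  assumes "\<And>s. s < h n \<Longrightarrow> Phi X s \<Longrightarrow> N s \<le> n div 4"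
  shows "machine h (description X n) = Some (init_seg (Phi X) (h n))"
proof -
  have "(N s \<le> n div 4 \<and> B (seg X (n div 4)) s) = Phi X s" if "s < h n" for s
    using assms[OF that] Phi_eq by blast
  then show ?thesis by (simp add: machine_def decode_def description init_seg_def)
qed

text \<open>Suppose \<open>s < h n\<close> lies in \<open>Phi X\<close> with use beyond
  \<open>n div 4\<close>, and let \<open>k = pfst s\<close>. Then \<open>n < 4 * G k\<close>, so for
  large \<open>k\<close> domination gives \<open>h n \<le> h (4 * G k) \<le> f k \<le> s\<close>, a
  contradiction. Hence the description of \<open>n\<close> yields the correct segment.\<close>

lemma anti_complex_Phi:
  assumes U: "optimal_machine U"
    and G: "computable G" "\<And>s. N s \<le> G (pfst s)"
    and f: "\<And>g. computable g \<Longrightarrow> dominates f g" "\<And>s. Phi X s \<Longrightarrow> f (pfst s) \<le> s"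
  shows "anti_complex U (Phi X)"
  unfolding anti_complex_def
proof (intro allI impI)
  fix h assume "computable h \<and> is_order h"
  then have h: "computable h" "mono h" by (auto simp: is_order_def)
  from U prefix_free_machine_machine[OF h(1)] obtain c where
    c: "\<And>\<sigma> \<tau>. machine h \<sigma> = Some \<tau> \<Longrightarrow> \<exists>\<rho>. U \<rho> = Some \<tau> \<and> length \<rho> \<le> length \<sigma> + c"
    unfolding optimal_machine_def by blast
  have "computable (\<lambda>k. h (4 * G k))"
    unfolding computable_iff_rec_in
    by (intro rec_in_computable[OF h(1)] rec_intros rec_in_computable[OF G(1)])
  then obtain k0 where k0: "\<And>k. k0 \<le> k \<Longrightarrow> h (4 * G k) \<le> f k"
    using f(1) unfolding dominates_def eventually_sequentially by blast
  \<comment> \<open>The first bound keeps \<open>G k\<close> within \<open>n div 4\<close> for the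
    finitely many \<open>k < k0\<close>; the second lets the spare quarter of \<open>n\<close>
    absorb \<open>c\<close> and the two bits after the block of ones.\<close>
  have "K U (init_seg (Phi X) (h n)) \<le> n" if n: "n \<ge> 4 * (\<Sum>k<k0. G k)" "n \<ge> 4 * c + 8" for n
  proof -
    have "N s \<le> n div 4" if s: "s < h n" "Phi X s" for s
    proof (rule ccontr)
      assume "\<not> N s \<le> n div 4"
      with G(2)[of s] have *: "n div 4 < G (pfst s)" by linarith
      have "k0 \<le> pfst s"
      proof (rule ccontr)
        assume "\<not> k0 \<le> pfst s"
        then have "G (pfst s) \<le> (\<Sum>k<k0. G k)" by (intro member_le_sum) auto
        with * n(1) show False by linarith
      qed
      then have "h (4 * G (pfst s)) \<le> s" using k0 f(2)[OF s(2)] by (meson order_trans)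
      moreover have "h n \<le> h (4 * G (pfst s))" using * by (intro monoD[OF h(2)]) linarith
      ultimately show False using s(1) by linarith
    qed
    from c[OF machine_description[OF this]] obtain \<rho> where
      "U \<rho> = Some (init_seg (Phi X) (h n))" "length \<rho> \<le> length (description X n) + c" by blast
    with K_le[of U \<rho>] have "K U (init_seg (Phi X) (h n)) \<le> n div 2 + 2 + n div 4 + c"
      by (fastforce simp: description_def)
    moreover have "a + 2 + b + c \<le> n" if "a * 2 \<le> n" "b * 4 \<le> n" for a b
      using that n(2) by linarith
    ultimately show ?thesis by (meson div_times_less_eq_dividend order_trans)
  qed
  then show "\<forall>\<^sub>F n in sequentially. K U (init_seg (Phi X) (h n)) \<le> n"
    unfolding eventually_sequentially
    by (intro exI[of _ "max (4 * (\<Sum>k<k0. G k)) (4 * c + 8)"]) simp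
qed

end

section \<open>Coding \<open>X\<close> together with bounds on \<open>f\<close>\<close>

theorem theorem5p4:
  fixes U :: "bool list \<Rightarrow> bool list option"
    and X :: "nat \<Rightarrow> bool"
    and f :: "nat \<Rightarrow> nat"
  assumes "optimal_machine U"
    and "martin_loef_random lebesgue_cantor X"
    and "wtt_le f X"
    and "\<And>g. computable g \<Longrightarrow> dominates f g"
  shows "\<exists>Y. anti_complex U Y \<and> proper Y \<and> turing_equiv Y X"
proof -
  from assms(3) obtain p g where g: "computable g" "\<And>n. runs X {..<g n} p n (f n)"
    unfolding wtt_le_def by blast
  \<comment> \<open>\<open>Suc n\<close> makes bit \<open>n\<close> of \<open>X\<close> available,
    and \<open>g n\<close> covers the queries in the computation of \<open>f n\<close>.\<close>
  define G where "G n = Suc n + g n" for n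
  define N where "N s = G (pfst s)" for s
  \<comment> \<open>With \<open>s\<close> coding \<langle>n, b, m\<rangle>, the number
    \<open>m\<close> is both the clock and the bound on the output. As \<open>ev\<close> returns the
    successor of the output, it is compared with \<open>Suc m\<close>.\<close>
  define B where "B z s \<longleftrightarrow> pfst (psnd s) = of_bool (bit z (pfst s)) \<and>
      0 < ev p (g (pfst s)) z (pfst s) (psnd (psnd s)) \<and>
      ev p (g (pfst s)) z (pfst s) (psnd (psnd s)) \<le> Suc (psnd (psnd s))" for z s
  have G: "computable G"
    unfolding computable_iff_rec_in G_def by (intro rec_intros rec_in_computable[OF g(1)])
  interpret tt_functional N B
  proof
    show "computable N"
      unfolding computable_iff_rec_in N_def by (intro rec_intros rec_in_computable[OF G])
    show "computable (\<lambda>y. of_bool (B (pfst y) (psnd y)))"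
      unfolding computable_iff_rec_in B_def
      by (intro rec_intros rec_in_ev rec_in_computable[OF g(1)])
    show "B z s = B z' s" if "\<And>i. i < N s \<Longrightarrow> bit z i = bit z' i" for z z' s
    proof -
      have "bit z (pfst s) = bit z' (pfst s)" using that by (simp add: N_def G_def)
      moreover have "ev p (g (pfst s)) z n t = ev p (g (pfst s)) z' n t" for n t
        using that by (intro ev_cong) (simp add: N_def G_def)
      ultimately show ?thesis by (simp add: B_def)
    qed
  qed
  have agree: "\<forall>i<g n. bit (seg X (G n)) i = X i" for n by (auto simp: bit_seg G_def)
  have ev_f: "\<forall>\<^sub>F t in sequentially. ev p (g n) (seg X (G n)) n t = Suc (f n)" for n
    by (rule ev_complete[OF g(2) agree])
  \<comment> \<open>Soundness gives a run on the finite oracle, agreement below \<open>g n\<close>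
    moves it to \<open>X\<close>, and determinism identifies its output.\<close>
  have ev_eq: "m = f n" if "ev p (g n) (seg X (G n)) n t = Suc m" for n m t
    using runs_det[OF runs_change_oracle[OF ev_sound[OF that], of "{..<g n}" X] g(2)] agree by auto
  have Phi_f: "f (pfst s) \<le> psnd (psnd s)" if "Phi X s" for s
  proof -
    let ?e = "ev p (g (pfst s)) (seg X (G (pfst s))) (pfst s) (psnd (psnd s))"
    from that have "0 < ?e" "?e \<le> Suc (psnd (psnd s))" by (simp_all add: Phi_def B_def N_def)
    moreover from this have "?e = Suc (f (pfst s))" using ev_eq by (metis Suc_pred)
    ultimately show ?thesis by simp
  qed
  have "anti_complex U (Phi X)"
  proof (rule anti_complex_Phi[OF assms(1) G _ assms(4)])
    \<comment> \<open>The pairing function is at least each of its arguments, so \<open>s\<close> is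
      at least its component \<open>m\<close>.\<close>
    show "f (pfst s) \<le> s" if "Phi X s" for s
      using Phi_f[OF that] le_prod_encode_2[of "psnd (psnd s)" "pfst (psnd s)"]
        le_prod_encode_2[of "psnd s" "pfst s"] by simp
  qed (simp add: N_def)
  moreover have "turing_le X (Phi X)"
  proof -
    have ex: "\<exists>k. Phi X (prod_encode (n, k))" for n
    proof -
      \<comment> \<open>The clock must suffice for convergence and also bound the output.\<close>
      have "\<forall>\<^sub>F t in sequentially. ev p (g n) (seg X (G n)) n t = Suc (f n) \<and> f n \<le> t"
        by (intro eventually_conj ev_f eventually_ge_at_top)
      then obtain t where "ev p (g n) (seg X (G n)) n t = Suc (f n)" "f n \<le> t"
        by (auto simp: eventually_sequentially)
      then have "Phi X (prod_encode (n, prod_encode (of_bool (X n), t)))"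
        by (simp add: Phi_def B_def N_def bit_seg) (simp add: G_def)
      then show ?thesis ..
    qed
    \<comment> \<open>Every element of \<open>Phi X\<close> carries a correct bit, so the first one
      found by the search reveals \<open>X n\<close>.\<close>
    have "pfst k = of_bool (X n)" if "Phi X (prod_encode (n, k))" for n k
      using that by (simp add: Phi_def B_def N_def bit_seg) (simp add: G_def)
    then have "of_bool (X n) = pfst (LEAST k. Phi X (prod_encode (n, k)))" for n
      using LeastI_ex[OF ex[of n]] by simp
    moreover have "rec_in (Phi X) UNIV (\<lambda>n. pfst (LEAST k. Phi X (prod_encode (n, k))))"
      by (intro rec_in_pfst rec_in_Least ex rec_in_oracle rec_intros)
    ultimately show ?thesis unfolding turing_le_def computable_from_iff_rec_in by simp
  qed
  ultimately show ?thesis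
    using proper_Phi[OF assms(2)] turing_le_Phi unfolding turing_equiv_def by blast
qed

end
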